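(* Let $f$ and $m$ be positive integers such that $f$ is not a multiple of $m$ and $m\le f+1$. Let $G(\mathcal A\mathrm{MED}(f,m))$ be the directed graph with vertex set $\mathcal A\mathrm{MED}(f,m)$ in which $(S,T)$ is an edge if and only if $T=S\setminus\{\operatorname{r}(S)\}$. Then $G(\mathcal A\mathrm{MED}(f,m))$ is a tree with root $\Delta(f,m)=\langle m\rangle\cup\{0,f+1,f+2,\dots\}$. Moreover, for $T\in\mathcal A\mathrm{MED}(f,m)$, the set of children of $T$ in $G(\mathcal A\mathrm{MED}(f,m))$ is $$\bigl\{T\cup\{x\}\in\mathrm{MED}(f,m)\mid x\in\operatorname{SG}(T),\ \operatorname{m}(T)<x<\operatorname{r}(T),\ \{x+1,x-1\}\subset\mathcal H(T)\bigr\}.$$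
   Context: $\mathbb N=\{0,1,2,\dots\}$. A numerical semigroup is a submonoid $S$ of $(\mathbb N,+)$ with finite complement $\mathcal H(S)=\mathbb N\setminus S$; $\operatorname{Fb}(S)=\max\mathcal H(S)$ is its Frobenius number ($-1$ if $S=\mathbb N$), $\operatorname{m}(S)=\min(S\setminus\{0\})$ its multiplicity, $\operatorname{e}(S)$ its embedding dimension (the cardinality of its unique minimal generating set), and $\operatorname{r}(S)=\min(S\setminus\langle\operatorname{m}(S)\rangle)$ its ratio, where $\langle m\rangle=\{\lambda m\mid\lambda\in\mathbb N\}$. The set of special gaps is $\operatorname{SG}(S)=\{x\in\mathcal H(S)\mid 2x\in S\text{ and }x+s\in S\text{ for all }s\in S\setminus\{0\}\}$. $S$ is an $\mathcal A$-semigroup if there is no $s$ with $s,s+1\in S$ and $s,s+1<\operatorname{Fb}(S)$. $S$ is a MED-semigroup if $\operatorname{e}(S)=\operatorname{m}(S)$; $\mathrm{MED}(f,m)$ is the set of all MED-semigroups with Frobenius number $f$ and multiplicity $m$. An $\mathcal A\mathrm{MED}$-semigroup is a numerical semigroup that is both an $\mathcal A$-semigroup and a MED-semigroup; $\mathcal A\mathrm{MED}(f,m)$ is the set of all $\mathcal A\mathrm{MED}$-semigroups with Frobenius number $f$ and multiplicity $m$. A directed graph is a tree with root $R$ if every vertex $S$ is connected to $R$ by a unique sequence of edges $(S_0,S_1),\dots,(S_{n-1},S_n)$ with $S_0=S$, $S_n=R$ (the empty sequence when $S=R$). If $(S,T)$ is an edge, $S$ is called a child of $T$. *)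

theory Defs
  imports "HOL.Hull" "Graph_Theory.Pair_Digraph"
begin

definition nat_submonoid :: "nat set \<Rightarrow> bool" where
  "nat_submonoid S \<longleftrightarrow> 0 \<in> S \<and> (\<forall>x\<in>S. \<forall>y\<in>S. x + y \<in> S)"

abbreviation gaps :: "nat set \<Rightarrow> nat set" where
  "gaps S \<equiv> - S"

definition numerical_semigroup :: "nat set \<Rightarrow> bool" where
  "numerical_semigroup S \<longleftrightarrow> nat_submonoid S \<and> finite (gaps S)"

definition Fb :: "nat set \<Rightarrow> int" where
  "Fb S = (if gaps S = {} then -1 else int (Max (gaps S)))"

definition sg_multiplicity :: "nat set \<Rightarrow> nat" where
  "sg_multiplicity S = (LEAST x. x \<in> S - {0})"

definition generated :: "nat set \<Rightarrow> nat set" where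
  "generated A = nat_submonoid hull A"

definition minimal_generating_set :: "nat set \<Rightarrow> nat set \<Rightarrow> bool" where
  "minimal_generating_set S A \<longleftrightarrow> generated A = S \<and> (\<forall>B. B \<subset> A \<longrightarrow> generated B \<noteq> S)"

lemma nat_submonoid_generated: "nat_submonoid (generated A)"
  unfolding generated_def hull_def nat_submonoid_def by blast

lemma ex1_minimal_generating_set:
  assumes "nat_submonoid S"
  shows "\<exists>!A. minimal_generating_set S A"
proof -
  define I where "I = {x \<in> S - {0}. \<not> (\<exists>a \<in> S - {0}. \<exists>b \<in> S - {0}. x = a + b)}"
  have sub: "I \<subseteq> A" if "generated A = S" for A
  proof
    fix x assume x: "x \<in> I"
    show "x \<in> A"
    proof (rule ccontr)
      assume "x \<notin> A"
      moreover have "A \<subseteq> S"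
        using that unfolding generated_def by (metis hull_subset)
      ultimately have "A \<subseteq> S - {x}" by blast
      moreover have "nat_submonoid (S - {x})"
      proof -
        have "a + b \<in> S - {x}" if ab: "a \<in> S - {x}" "b \<in> S - {x}" for a b
        proof (cases "a = 0 \<or> b = 0")
          case True
          then show ?thesis using ab by auto
        next
          case False
          then have "a \<in> S - {0}" "b \<in> S - {0}" using ab by auto
          then have "x \<noteq> a + b" using x unfolding I_def by blast
          moreover have "a + b \<in> S" using assms ab unfolding nat_submonoid_def by blast
          ultimately show ?thesis by simp
        qed
        moreover have "0 \<in> S - {x}"
          using assms x unfolding nat_submonoid_def I_def by simp
        ultimately show ?thesis unfolding nat_submonoid_def by blast
      qed
      ultimately have "generated A \<subseteq> S - {x}"
        unfolding generated_def by (rule hull_minimal)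
      then show False using that x unfolding I_def by blast
    qed
  qed
  have "x \<in> generated I" if "x \<in> S" for x
    using that
  proof (induction x rule: less_induct)
    case (less x)
    consider "x = 0" | "x \<in> I"
      | a b where "a \<in> S - {0}" "b \<in> S - {0}" "x = a + b"
      using less.prems unfolding I_def by blast
    then show ?case
    proof cases
      case 1
      then show ?thesis using nat_submonoid_generated unfolding nat_submonoid_def by blast
    next
      case 2
      then show ?thesis unfolding generated_def by (rule hull_inc)
    next
      case 3
      then have "a \<in> generated I" "b \<in> generated I" using less.IH by auto
      then show ?thesis
        using 3 nat_submonoid_generated unfolding nat_submonoid_def by blast
    qed
  qed
  moreover have "generated I \<subseteq> S"
    unfolding generated_def using assms by (intro hull_minimal) (auto simp: I_def)
  ultimately have gen: "generated I = S" by blast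
  show ?thesis
  proof (rule ex1I)
    show "minimal_generating_set S I"
      unfolding minimal_generating_set_def using gen sub by blast
    show "A = I" if "minimal_generating_set S A" for A
      using that gen sub unfolding minimal_generating_set_def by blast
  qed
qed

text \<open>The description is proper for every numerical semigroup, by the preceding lemma.\<close>

definition embedding_dim :: "nat set \<Rightarrow> nat" where
  "embedding_dim S = card (THE A. minimal_generating_set S A)"

definition multiples :: "nat \<Rightarrow> nat set" where
  "multiples m = {k * m | k. True}"

text \<open>For \<open>S = UNIV\<close> there is no element outside \<open>multiples (sg_multiplicity S)\<close>, and the value of
  \<open>ratio S\<close> is unspecified.  Every other numerical semigroup has such an element.\<close>

definition ratio :: "nat set \<Rightarrow> nat" where
  "ratio S = (LEAST x. x \<in> S - multiples (sg_multiplicity S))"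

definition special_gaps :: "nat set \<Rightarrow> nat set" where
  "special_gaps S = {x \<in> gaps S. 2 * x \<in> S \<and> (\<forall>s \<in> S - {0}. x + s \<in> S)}"

definition A_semigroup :: "nat set \<Rightarrow> bool" where
  "A_semigroup S \<longleftrightarrow> numerical_semigroup S \<and>
     \<not> (\<exists>s. s \<in> S \<and> s + 1 \<in> S \<and> int s < Fb S \<and> int (s + 1) < Fb S)"

definition MED_semigroup :: "nat set \<Rightarrow> bool" where
  "MED_semigroup S \<longleftrightarrow> numerical_semigroup S \<and> embedding_dim S = sg_multiplicity S"

definition MED :: "nat \<Rightarrow> nat \<Rightarrow> nat set set" where
  "MED f m = {S. MED_semigroup S \<and> Fb S = int f \<and> sg_multiplicity S = m}"

definition AMED :: "nat \<Rightarrow> nat \<Rightarrow> nat set set" where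
  "AMED f m = {S. A_semigroup S \<and> MED_semigroup S \<and> Fb S = int f \<and> sg_multiplicity S = m}"

definition AMED_graph :: "nat \<Rightarrow> nat \<Rightarrow> nat set pair_pre_digraph" where
  "AMED_graph f m =
     \<lparr> pverts = AMED f m,
       parcs = {(S, T). S \<in> AMED f m \<and> T \<in> AMED f m \<and> T = S - {ratio S}} \<rparr>"

definition Delta :: "nat \<Rightarrow> nat \<Rightarrow> nat set" where
  "Delta f m = multiples m \<union> {0} \<union> {f + 1..}"

text \<open>Edges point towards the root.  An \<open>awalk\<close> from \<open>v\<close> to \<open>R\<close> is a possibly empty list of
  consecutive edges leading from \<open>v\<close> to \<open>R\<close>.\<close>

definition is_tree_with_root :: "'a pair_pre_digraph \<Rightarrow> 'a \<Rightarrow> bool" where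
  "is_tree_with_root G R \<longleftrightarrow> pair_wf_digraph G \<and> R \<in> pverts G \<and>
     (\<forall>v \<in> pverts G. \<exists>!p. pre_digraph.awalk (with_proj G) v p R)"

definition children :: "'a pair_pre_digraph \<Rightarrow> 'a \<Rightarrow> 'a set" where
  "children G T = {S. (S, T) \<in> parcs G}"

end

theory Submission
  imports Defs
begin

text \<open>
  Removing the ratio is an operation that always moves a semigroup of the family one step
  closer to \<open>Delta f m\<close>. Everything rests on the classical description of maximal embedding
  dimension (lemma \<open>MED_semigroup_iff\<close>): a numerical semigroup \<open>S\<close> of multiplicity \<open>m\<close> is
  MED iff \<open>x + y - m \<in> S\<close> for all nonzero \<open>x, y \<in> S\<close>. It holds because every minimal generator
  is \<open>m\<close> or a nonzero element of the Apery set of \<open>m\<close>; these are \<open>m\<close> candidates altogether,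
  one per residue class, so the embedding dimension equals \<open>m\<close> exactly when none of them
  decomposes.

  All elements of \<open>S\<close> below its ratio \<open>r\<close> are multiples of \<open>m\<close>, whereas \<open>r\<close> is not. If \<open>x\<close> and
  \<open>y\<close> are nonzero elements of \<open>S - {r}\<close> with \<open>r = x + y\<close> or \<open>r = x + y - m\<close>, then both are below
  \<open>r\<close>, because nonzero elements are at least \<open>m\<close>; so \<open>m\<close> would divide \<open>r\<close>. Hence \<open>S - {r}\<close> is
  again a MED-semigroup. If \<open>S \<noteq> Delta f m\<close>, then \<open>r < f\<close>, so neither the
  Frobenius number nor the multiplicity changes, and the absence of consecutive elements
  is inherited by subsets (lemma \<open>AMED_remove_ratio\<close>). For \<open>Delta f m\<close> the ratio exceeds \<open>f\<close>,
  and removing it leaves the family. Thus every vertex except the root has exactly one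
  outgoing edge, and the number of elements below \<open>f\<close> decreases along it; such a graph is a
  tree (lemma \<open>functional_graph_is_tree\<close>).

  Reading an edge backwards, a child adds to \<open>T\<close> an element that becomes the new ratio. The
  order conditions on \<open>x\<close> say exactly this, and the condition on \<open>x + 1\<close> and \<open>x - 1\<close> says
  that no two consecutive elements appear.
\<close>

section \<open>Minimal generators\<close>

definition irreducibles :: "nat set \<Rightarrow> nat set" where
  "irreducibles S = {x \<in> S - {0}. \<forall>a \<in> S - {0}. \<forall>b \<in> S - {0}. x \<noteq> a + b}"

lemma nat_submonoid_add:
  assumes "nat_submonoid S" "x \<in> S" "y \<in> S"
  shows "x + y \<in> S"
  using assms unfolding nat_submonoid_def by blast

lemma nat_submonoid_multiple:
  assumes "nat_submonoid S" "x \<in> S"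
  shows "k * x \<in> S"
  using assms by (induction k) (auto simp: nat_submonoid_def)

lemma nat_submonoid_remove_irreducible:
  assumes "nat_submonoid S" "x \<in> irreducibles S"
  shows "nat_submonoid (S - {x})"
  unfolding nat_submonoid_def
proof (intro conjI ballI)
  show "0 \<in> S - {x}" using assms unfolding nat_submonoid_def irreducibles_def by auto
  show "a + b \<in> S - {x}" if ab: "a \<in> S - {x}" "b \<in> S - {x}" for a b
  proof (cases "a = 0 \<or> b = 0")
    case True
    then show ?thesis using ab by auto
  next
    case False
    then have "x \<noteq> a + b" using ab assms(2) unfolding irreducibles_def by blast
    then show ?thesis using nat_submonoid_add[OF assms(1), of a b] ab by blast
  qed
qed

text \<open>Removing an irreducible element leaves a submonoid, which contains everything that
  generators other than this element can produce.\<close>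

lemma irreducibles_subset_generating:
  assumes "nat_submonoid S" "generated A = S"
  shows "irreducibles S \<subseteq> A"
proof
  fix x assume x: "x \<in> irreducibles S"
  show "x \<in> A"
  proof (rule ccontr)
    assume "x \<notin> A"
    moreover have "A \<subseteq> S"
      using assms(2) unfolding generated_def by (metis hull_subset)
    ultimately have "generated A \<subseteq> S - {x}"
      unfolding generated_def
      using nat_submonoid_remove_irreducible[OF assms(1) x] by (intro hull_minimal) auto
    then show False
      using assms(2) x unfolding irreducibles_def by blast
  qed
qed

lemma generated_irreducibles:
  assumes "nat_submonoid S"
  shows "generated (irreducibles S) = S"
proof
  show "generated (irreducibles S) \<subseteq> S"
    unfolding generated_def using assms by (intro hull_minimal) (auto simp: irreducibles_def)
  have "x \<in> generated (irreducibles S)" if "x \<in> S" for x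
    using that
  proof (induction x rule: less_induct)
    case (less x)
    show ?case
    proof (cases "x = 0 \<or> x \<in> irreducibles S")
      case True
      then show ?thesis
        using nat_submonoid_generated[of "irreducibles S"]
        by (auto simp: nat_submonoid_def generated_def hull_inc)
    next
      case False
      then obtain a b where "a \<in> S - {0}" "b \<in> S - {0}" "x = a + b"
        using less.prems unfolding irreducibles_def by blast
      then show ?thesis
        using less.IH by (auto intro: nat_submonoid_add[OF nat_submonoid_generated])
    qed
  qed
  then show "S \<subseteq> generated (irreducibles S)" by blast
qed

lemma embedding_dim_eq_card_irreducibles:
  assumes "nat_submonoid S"
  shows "embedding_dim S = card (irreducibles S)"
proof -
  have "minimal_generating_set S (irreducibles S)"
    unfolding minimal_generating_set_def
    using generated_irreducibles[OF assms] irreducibles_subset_generating[OF assms] by blast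
  then have "(THE A. minimal_generating_set S A) = irreducibles S"
    using ex1_minimal_generating_set[OF assms] by (rule the1_equality[rotated])
  then show ?thesis unfolding embedding_dim_def by simp
qed

section \<open>Multiplicity and Frobenius number\<close>

lemma numerical_semigroup_mem_above:
  assumes "numerical_semigroup S"
  shows "\<exists>b. \<forall>x>b. x \<in> S"
  using assms unfolding numerical_semigroup_def finite_nat_set_iff_bounded_le
  by (metis ComplI linorder_not_less)

lemma sg_multiplicity_mem:
  assumes "numerical_semigroup S"
  shows "sg_multiplicity S \<in> S" "sg_multiplicity S > 0"
proof -
  obtain b where "\<forall>x>b. x \<in> S" using numerical_semigroup_mem_above[OF assms] by blast
  then have "Suc b \<in> S - {0}" by auto
  then have "sg_multiplicity S \<in> S - {0}"
    unfolding sg_multiplicity_def by (rule LeastI)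
  then show "sg_multiplicity S \<in> S" "sg_multiplicity S > 0" by auto
qed

lemma sg_multiplicity_le:
  assumes "x \<in> S" "x > 0"
  shows "sg_multiplicity S \<le> x"
  unfolding sg_multiplicity_def using assms by (intro Least_le) auto

lemma sg_multiplicity_eqI:
  assumes "m \<in> S" "m > 0" "\<And>x. x \<in> S \<Longrightarrow> x > 0 \<Longrightarrow> m \<le> x"
  shows "sg_multiplicity S = m"
  unfolding sg_multiplicity_def using assms by (intro Least_equality) auto

lemma Fb_eq_int_iff:
  assumes "finite (gaps S)"
  shows "Fb S = int f \<longleftrightarrow> f \<notin> S \<and> {f + 1..} \<subseteq> S"
proof
  assume "Fb S = int f"
  then have ne: "gaps S \<noteq> {}" and f: "Max (gaps S) = f"
    unfolding Fb_def by (auto split: if_splits)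
  have "x \<in> S" if "x > f" for x
    using Max_ge[OF assms, of x] f that by auto
  moreover have "f \<notin> S" using Max_in[OF assms ne] f by simp
  ultimately show "f \<notin> S \<and> {f + 1..} \<subseteq> S" by auto
next
  assume f: "f \<notin> S \<and> {f + 1..} \<subseteq> S"
  have "Max (gaps S) = f"
  proof (rule Max_eqI[OF assms])
    show "y \<le> f" if "y \<in> gaps S" for y
      using f that by (metis ComplD Suc_eq_plus1 atLeast_iff not_less_eq_eq subsetD)
  qed (use f in simp)
  then show "Fb S = int f" unfolding Fb_def using f by auto
qed

section \<open>Maximal embedding dimension\<close>

text \<open>The classical condition is \<open>w - m \<notin> S\<close> with an integer difference, which holds
  automatically for \<open>w < m\<close>. The truncated difference is then \<open>0 \<in> S\<close>, so this case is listed
  separately.\<close>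

definition Apery :: "nat set \<Rightarrow> nat \<Rightarrow> nat set" where
  "Apery S m = {w \<in> S. w < m \<or> w - m \<notin> S}"

text \<open>The Apery set consists of the least elements of \<open>S\<close> in the \<open>m\<close> residue classes: any other
  element of the class is the least one plus a positive multiple of \<open>m\<close>, so subtracting \<open>m\<close>
  from it does not leave \<open>S\<close>.\<close>

lemma bij_betw_Apery:
  assumes S: "numerical_semigroup S" and m: "m \<in> S" "m > 0"
  shows "bij_betw (\<lambda>w. w mod m) (Apery S m) {..<m}"
proof (rule bij_betw_imageI)
  have mon: "nat_submonoid S" using S unfolding numerical_semigroup_def by blast
  have no_less: False
    if v: "v \<in> Apery S m" and w: "w \<in> Apery S m" and cong: "v mod m = w mod m" and "v < w"
    for v w
  proof -
    obtain k where k: "w = v + m * k"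
      using cong \<open>v < w\<close> by (metis less_imp_le mod_eq_nat1E)
    with \<open>v < w\<close> obtain j where "k = Suc j" by (cases k) auto
    with k have w_eq: "w = v + j * m + m" by (simp add: algebra_simps)
    have "v + j * m \<in> S"
      using v nat_submonoid_multiple[OF mon m(1)] nat_submonoid_add[OF mon]
      unfolding Apery_def by blast
    then show False using w w_eq unfolding Apery_def by auto
  qed
  show "inj_on (\<lambda>w. w mod m) (Apery S m)"
    by (rule inj_onI) (metis no_less linorder_neqE_nat)
  have "i \<in> (\<lambda>w. w mod m) ` Apery S m" if i: "i < m" for i
  proof -
    obtain b where b: "\<forall>x>b. x \<in> S" using numerical_semigroup_mem_above[OF S] by blast
    have "i + Suc b * m > b" using m(2) by (cases m) auto
    then have ex: "i + Suc b * m \<in> S \<and> (i + Suc b * m) mod m = i"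
      using b i by (metis mod_less mod_mult_self1)
    define w where "w = (LEAST x. x \<in> S \<and> x mod m = i)"
    have w: "w \<in> S" "w mod m = i"
      unfolding w_def using LeastI[of "\<lambda>x. x \<in> S \<and> x mod m = i", OF ex] by auto
    have "w - m \<notin> S" if "\<not> w < m"
    proof
      assume "w - m \<in> S"
      moreover have "(w - m) mod m = i" using that w(2) by (simp add: le_mod_geq)
      ultimately have "w \<le> w - m" unfolding w_def by (intro Least_le) blast
      then show False using that m(2) by simp
    qed
    then have "w \<in> Apery S m" using w unfolding Apery_def by blast
    then show ?thesis using w(2) by blast
  qed
  then show "(\<lambda>w. w mod m) ` Apery S m = {..<m}" using m(2) by auto
qed

theorem MED_semigroup_iff:
  assumes S: "numerical_semigroup S" and m: "sg_multiplicity S = m"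
  shows "MED_semigroup S \<longleftrightarrow> (\<forall>x \<in> S - {0}. \<forall>y \<in> S - {0}. x + y - m \<in> S)"
proof -
  have mon: "nat_submonoid S" using S unfolding numerical_semigroup_def by blast
  have mS: "m \<in> S" "m > 0" using sg_multiplicity_mem[OF S] m by auto
  have m_le: "m \<le> x" if "x \<in> S" "x > 0" for x using sg_multiplicity_le[OF that] m by simp
  \<comment> \<open>Trading the Apery element \<open>0\<close> for \<open>m\<close> gives all candidates for minimal generators.\<close>
  define C where "C = insert m (Apery S m - {0})"
  have bij: "bij_betw (\<lambda>w. w mod m) (Apery S m) {..<m}" by (rule bij_betw_Apery[OF S mS])
  have fin: "finite (Apery S m)" using bij_betw_finite[OF bij] by simp
  have "card (Apery S m) = m" using bij_betw_same_card[OF bij] by simp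
  moreover have "0 \<in> Apery S m" "m \<notin> Apery S m"
    using mon mS unfolding Apery_def nat_submonoid_def by auto
  ultimately have cardC: "card C = m" unfolding C_def using fin mS(2) by simp
  have finC: "finite C" unfolding C_def using fin by simp
  have sub: "irreducibles S \<subseteq> C"
  proof
    fix x assume x: "x \<in> irreducibles S"
    then have xS: "x \<in> S" "x > 0" unfolding irreducibles_def by auto
    have "x - m \<notin> S" if "x \<noteq> m"
    proof
      assume "x - m \<in> S"
      then have "x - m \<in> S - {0}" "x = (x - m) + m" using that m_le[OF xS] by auto
      then show False using x mS unfolding irreducibles_def by blast
    qed
    then show "x \<in> C" using xS unfolding C_def Apery_def by blast
  qed
  have "MED_semigroup S \<longleftrightarrow> card (irreducibles S) = m"
    unfolding MED_semigroup_def using S m embedding_dim_eq_card_irreducibles[OF mon] by simp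
  also have "\<dots> \<longleftrightarrow> irreducibles S = C"
    using card_subset_eq[OF finC sub] cardC by auto
  also have "\<dots> \<longleftrightarrow> (\<forall>x \<in> S - {0}. \<forall>y \<in> S - {0}. x + y - m \<in> S)"
  proof
    assume eq: "irreducibles S = C"
    show "\<forall>x \<in> S - {0}. \<forall>y \<in> S - {0}. x + y - m \<in> S"
    proof (intro ballI)
      fix x y assume xy: "x \<in> S - {0}" "y \<in> S - {0}"
      then have "x + y \<notin> C" unfolding eq[symmetric] irreducibles_def by blast
      then show "x + y - m \<in> S"
        using xy nat_submonoid_add[OF mon, of x y] unfolding C_def Apery_def by auto
    qed
  next
    assume closed: "\<forall>x \<in> S - {0}. \<forall>y \<in> S - {0}. x + y - m \<in> S"
    have "w \<in> irreducibles S" if w: "w \<in> C" for w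
    proof -
      have "w \<noteq> a + b" if ab: "a \<in> S - {0}" "b \<in> S - {0}" for a b
      proof
        assume "w = a + b"
        moreover have "a + b - m \<in> S" using closed ab by blast
        moreover have "m \<le> a" "b > 0" using m_le ab by auto
        ultimately show False using w unfolding C_def Apery_def by auto
      qed
      moreover have "w \<in> S - {0}" using w mS unfolding C_def Apery_def by auto
      ultimately show ?thesis unfolding irreducibles_def by blast
    qed
    then show "irreducibles S = C" using sub by blast
  qed
  finally show ?thesis .
qed

section \<open>The ratio\<close>

lemma dvd_iff_mem_multiples: "m dvd x \<longleftrightarrow> x \<in> multiples m"
  unfolding multiples_def dvd_def by (auto simp: mult.commute)

lemma ratio_eqI:
  assumes "sg_multiplicity S = m" "r \<in> S" "\<not> m dvd r"
    and "\<And>x. x \<in> S \<Longrightarrow> x < r \<Longrightarrow> m dvd x"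
  shows "ratio S = r"
  unfolding ratio_def using assms
  by (intro Least_equality) (auto simp: dvd_iff_mem_multiples[symmetric] not_less[symmetric])

text \<open>Each of these conditions can be checked directly when a single element is removed; the
  embedding dimension itself is hard to follow through such a change.\<close>

lemma AMED_iff:
  "S \<in> AMED f m \<longleftrightarrow> nat_submonoid S \<and> f \<notin> S \<and> {f + 1..} \<subseteq> S \<and>
     m \<in> S \<and> m > 0 \<and> (\<forall>x\<in>S. x > 0 \<longrightarrow> m \<le> x) \<and>
     (\<forall>x \<in> S - {0}. \<forall>y \<in> S - {0}. x + y - m \<in> S) \<and>
     (\<forall>s\<in>S. s + 1 \<in> S \<longrightarrow> \<not> s + 1 < f)" (is "_ \<longleftrightarrow> ?R")
proof
  assume "S \<in> AMED f m"
  then have "A_semigroup S" "MED_semigroup S" and Fb: "Fb S = int f" and m: "sg_multiplicity S = m"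
    unfolding AMED_def by auto
  then have S: "numerical_semigroup S" unfolding A_semigroup_def by blast
  then have "nat_submonoid S" "f \<notin> S \<and> {f + 1..} \<subseteq> S"
    using Fb Fb_eq_int_iff unfolding numerical_semigroup_def by auto
  moreover have "\<forall>x \<in> S - {0}. \<forall>y \<in> S - {0}. x + y - m \<in> S"
    using MED_semigroup_iff[OF S m] \<open>MED_semigroup S\<close> by blast
  moreover have "\<forall>s\<in>S. s + 1 \<in> S \<longrightarrow> \<not> s + 1 < f"
    using \<open>A_semigroup S\<close> unfolding A_semigroup_def Fb
    by (metis add_lessD1 of_nat_less_iff)
  ultimately show ?R
    using sg_multiplicity_mem[OF S] sg_multiplicity_le[of _ S] m by simp
next
  assume R: ?R
  then have "gaps S \<subseteq> {..f}" by (auto simp: not_less_eq_eq[symmetric])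
  then have fin: "finite (gaps S)" by (rule finite_subset) simp
  then have S: "numerical_semigroup S" using R unfolding numerical_semigroup_def by blast
  have m: "sg_multiplicity S = m" using R by (intro sg_multiplicity_eqI) auto
  have Fb: "Fb S = int f" using Fb_eq_int_iff[OF fin] R by blast
  have "A_semigroup S" unfolding A_semigroup_def Fb using S R by auto
  moreover have "MED_semigroup S" using MED_semigroup_iff[OF S m] R by blast
  ultimately show "S \<in> AMED f m" unfolding AMED_def using Fb m by blast
qed

lemma AMED_sg_multiplicity: "S \<in> AMED f m \<Longrightarrow> sg_multiplicity S = m"
  unfolding AMED_def by blast

lemma AMED_ratio:
  assumes "S \<in> AMED f m" "\<not> m dvd f"
  shows "ratio S \<in> S" "\<not> m dvd ratio S" "\<And>x. x \<in> S \<Longrightarrow> x < ratio S \<Longrightarrow> m dvd x"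
proof -
  have mult: "sg_multiplicity S = m" by (rule AMED_sg_multiplicity[OF assms(1)])
  \<comment> \<open>A non-multiple exists: \<open>f + m\<close> lies beyond all gaps and is congruent to \<open>f\<close>.\<close>
  have "f + m \<in> S - multiples (sg_multiplicity S)"
    using assms mult unfolding AMED_iff by (auto simp: dvd_iff_mem_multiples[symmetric])
  then have "ratio S \<in> S - multiples (sg_multiplicity S)"
    unfolding ratio_def by (rule LeastI)
  then show "ratio S \<in> S" "\<not> m dvd ratio S"
    using mult by (auto simp: dvd_iff_mem_multiples)
  show "m dvd x" if "x \<in> S" "x < ratio S" for x
    using not_less_Least[of x "\<lambda>x. x \<in> S - multiples (sg_multiplicity S)"] that mult
    unfolding ratio_def by (auto simp: dvd_iff_mem_multiples)
qed

section \<open>The edges of the graph\<close>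

lemma mem_Delta_iff: "x \<in> Delta f m \<longleftrightarrow> m dvd x \<or> f < x"
  unfolding Delta_def using dvd_iff_mem_multiples[of m x] by auto

lemma Delta_in_AMED:
  assumes "f > 0" "m > 0" "\<not> m dvd f" "m \<le> f + 1"
  shows "Delta f m \<in> AMED f m"
proof -
  note D = mem_Delta_iff[of _ f m]
  have "nat_submonoid (Delta f m)" by (auto simp: nat_submonoid_def D)
  moreover have "m \<le> x" if "x \<in> Delta f m" "x > 0" for x
    using that assms(4) unfolding D by (auto dest: dvd_imp_le)
  moreover have "x + y - m \<in> Delta f m" if "x \<in> Delta f m - {0}" "y \<in> Delta f m - {0}" for x y
  proof (cases "m dvd x \<and> m dvd y")
    case True
    then show ?thesis unfolding D by (auto intro: dvd_diff_nat)
  next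
    case False
    have "m \<le> x" "m \<le> y" using that calculation(2) by auto
    moreover have "f < x \<or> f < y" using False that D by blast
    ultimately show ?thesis unfolding D by linarith
  qed
  moreover have False if "s \<in> Delta f m" "s + 1 \<in> Delta f m" "s + 1 < f" for s
  proof -
    have "m dvd s" "m dvd s + 1" using that unfolding D by auto
    then have "m dvd 1" using dvd_diff_nat[of m "s + 1" s] by simp
    then show False using assms(3) by simp
  qed
  ultimately show ?thesis
    unfolding AMED_iff using assms D by auto
qed

lemma AMED_ratio_less:
  assumes "S \<in> AMED f m" "\<not> m dvd f" "S \<noteq> Delta f m"
  shows "ratio S < f"
proof (rule ccontr)
  assume "\<not> ratio S < f"
  then have "x \<in> S \<Longrightarrow> x < f \<Longrightarrow> m dvd x" for x
    using AMED_ratio(3)[OF assms(1,2)] by auto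
  moreover have "m dvd x \<Longrightarrow> x \<in> S" for x
    using assms(1) nat_submonoid_multiple[of S m] unfolding AMED_iff
    by (metis dvd_div_mult_self)
  moreover have "f \<notin> S" "\<And>x. f < x \<Longrightarrow> x \<in> S" using assms(1) unfolding AMED_iff by auto
  ultimately have "x \<in> S \<longleftrightarrow> m dvd x \<or> f < x" for x
    by (metis linorder_neqE_nat)
  then have "S = Delta f m"
    using mem_Delta_iff by blast
  then show False using assms(3) by simp
qed

text \<open>Below the ratio all elements are multiples of \<open>m\<close>, and sums and differences of these never
  produce the ratio. This one remark gives closure of the remaining set under addition as
  well as under \<open>x + y - m\<close>.\<close>

lemma AMED_remove_ratio:
  assumes S: "S \<in> AMED f m" and f: "\<not> m dvd f" and ne: "S \<noteq> Delta f m"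
  shows "S - {ratio S} \<in> AMED f m"
proof -
  note r = AMED_ratio[OF S f]
  have S': "nat_submonoid S" "m \<in> S" "m > 0" "\<And>x. x \<in> S \<Longrightarrow> x > 0 \<Longrightarrow> m \<le> x"
    using S unfolding AMED_iff by auto
  have not_ratio: "x + y \<noteq> ratio S \<and> x + y - m \<noteq> ratio S"
    if "x \<in> S - {0, ratio S}" "y \<in> S - {0, ratio S}" for x y
  proof -
    have le: "m \<le> x" "m \<le> y" using that S'(4) by auto
    have dvd: "m dvd x \<and> m dvd y" if "x \<le> ratio S" "y \<le> ratio S"
      using r(3)[of x] r(3)[of y] that \<open>x \<in> _\<close> \<open>y \<in> _\<close> by auto
    have "m dvd x + y" "m dvd x + y - m" if "x \<le> ratio S" "y \<le> ratio S"
      using dvd[OF that] by (auto intro: dvd_diff_nat)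
    then show ?thesis using le r(2) by fastforce
  qed
  have "nat_submonoid (S - {ratio S})"
    unfolding nat_submonoid_def
  proof (intro conjI ballI)
    show "0 \<in> S - {ratio S}" using S'(1) r(2) unfolding nat_submonoid_def by (metis DiffI dvd_0_right singletonD)
    show "x + y \<in> S - {ratio S}" if "x \<in> S - {ratio S}" "y \<in> S - {ratio S}" for x y
      using that not_ratio[of x y] nat_submonoid_add[OF S'(1), of x y]
      by (cases "x = 0 \<or> y = 0") auto
  qed
  moreover have "x + y - m \<in> S - {ratio S}"
    if "x \<in> S - {ratio S} - {0}" "y \<in> S - {ratio S} - {0}" for x y
    using that not_ratio[of x y] S unfolding AMED_iff by blast
  moreover have "m \<noteq> ratio S" using r(2) by auto
  ultimately show ?thesis
    using S AMED_ratio_less[OF S f ne] unfolding AMED_iff by auto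
qed

lemma Delta_remove_ratio:
  assumes "f > 0" "m > 0" "\<not> m dvd f" "m \<le> f + 1"
  shows "Delta f m - {ratio (Delta f m)} \<notin> AMED f m"
proof -
  have D: "ratio (Delta f m) \<in> Delta f m" "\<not> m dvd ratio (Delta f m)"
    using AMED_ratio[OF Delta_in_AMED[OF assms] assms(3)] by auto
  then have "ratio (Delta f m) \<in> {f + 1..}" using mem_Delta_iff by auto
  then show ?thesis unfolding AMED_iff by blast
qed

section \<open>Trees from functional graphs\<close>

text \<open>Since the walk from a vertex never has a choice, and cannot continue at the root, it is
  unique; since the rank cannot decrease for ever, it arrives at the root.\<close>

lemma functional_graph_is_tree:
  fixes rank :: "'a \<Rightarrow> nat"
  assumes wf: "pair_wf_digraph G" and root: "R \<in> pverts G"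
    and out_unique: "\<And>u v w. (u, v) \<in> parcs G \<Longrightarrow> (u, w) \<in> parcs G \<Longrightarrow> v = w"
    and root_out: "\<And>v. (R, v) \<notin> parcs G"
    and descend: "\<And>v. v \<in> pverts G \<Longrightarrow> v \<noteq> R \<Longrightarrow> \<exists>w. (v, w) \<in> parcs G \<and> rank w < rank v"
  shows "is_tree_with_root G R"
proof -
  note cas = pre_digraph.cas.simps[of "with_proj G"]
  note awalk_def = pre_digraph.awalk_def[of "with_proj G"]
  have ex: "\<exists>p. set p \<subseteq> parcs G \<and> pre_digraph.cas (with_proj G) v p R" if "v \<in> pverts G" for v
    using that
  proof (induction "rank v" arbitrary: v rule: less_induct)
    case less
    show ?case
    proof (cases "v = R")
      case True
      then show ?thesis by (intro exI[of _ "[]"]) (simp add: cas)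
    next
      case False
      then obtain w where w: "(v, w) \<in> parcs G" "rank w < rank v"
        using descend less.prems by blast
      then have "w \<in> pverts G" using wf unfolding pair_wf_digraph_def by force
      then obtain p where "set p \<subseteq> parcs G" "pre_digraph.cas (with_proj G) w p R"
        using less.hyps w(2) by blast
      then show ?thesis using w(1) by (intro exI[of _ "(v, w) # p"]) (simp add: cas)
    qed
  qed
  have unique: "p = q"
    if "set p \<subseteq> parcs G" "pre_digraph.cas (with_proj G) v p R"
      "set q \<subseteq> parcs G" "pre_digraph.cas (with_proj G) v q R" for v p q
    using that
  proof (induction p arbitrary: v q)
    case Nil
    then have "v = R" by (simp add: cas)
    then show ?case using Nil.prems root_out by (cases q) (auto simp: cas)
  next
    case (Cons e p)
    obtain w where e: "e = (v, w)" "(v, w) \<in> parcs G"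
      using Cons.prems by (cases e) (auto simp: cas)
    obtain e' q' where q: "q = e' # q'"
      using Cons.prems e root_out by (cases q) (auto simp: cas)
    then obtain w' where e': "e' = (v, w')" "(v, w') \<in> parcs G"
      using Cons.prems by (cases e') (auto simp: cas)
    have "w' = w" using out_unique e(2) e'(2) by blast
    moreover have "p = q'"
      by (rule Cons.IH[of w]) (use Cons.prems e e' q \<open>w' = w\<close> in \<open>auto simp: cas\<close>)
    ultimately show ?case using e e' q by simp
  qed
  have "\<exists>!p. pre_digraph.awalk (with_proj G) v p R" if "v \<in> pverts G" for v
    using ex[OF that] unique[of _ v] that unfolding awalk_def by auto
  then show ?thesis unfolding is_tree_with_root_def using wf root by blast
qed

section \<open>The tree of AMED-semigroups\<close>

text \<open>The elements below \<open>f\<close> serve as the rank: every removal takes one of them away, because away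
  from the root the ratio is below \<open>f\<close>.\<close>

lemma AMED_graph_is_tree:
  assumes "f > 0" "m > 0" "\<not> m dvd f" "m \<le> f + 1"
  shows "is_tree_with_root (AMED_graph f m) (Delta f m)"
proof (rule functional_graph_is_tree[where rank = "\<lambda>S. card (S \<inter> {..<f})"])
  show "pair_wf_digraph (AMED_graph f m)"
    by unfold_locales (auto simp: AMED_graph_def)
  show "Delta f m \<in> pverts (AMED_graph f m)"
    using Delta_in_AMED[OF assms] by (simp add: AMED_graph_def)
  show "v = w" if "(u, v) \<in> parcs (AMED_graph f m)" "(u, w) \<in> parcs (AMED_graph f m)" for u v w
    using that by (simp add: AMED_graph_def)
  show "(Delta f m, v) \<notin> parcs (AMED_graph f m)" for v
    using Delta_remove_ratio[OF assms] by (auto simp: AMED_graph_def)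
  show "\<exists>T. (S, T) \<in> parcs (AMED_graph f m) \<and> card (T \<inter> {..<f}) < card (S \<inter> {..<f})"
    if "S \<in> pverts (AMED_graph f m)" "S \<noteq> Delta f m" for S
  proof (intro exI conjI)
    have S: "S \<in> AMED f m" using that(1) by (simp add: AMED_graph_def)
    show "(S, S - {ratio S}) \<in> parcs (AMED_graph f m)"
      using S AMED_remove_ratio[OF S assms(3) that(2)] by (simp add: AMED_graph_def)
    have "ratio S \<in> S \<inter> {..<f}"
      using AMED_ratio(1)[OF S assms(3)] AMED_ratio_less[OF S assms(3) that(2)] by simp
    then show "card ((S - {ratio S}) \<inter> {..<f}) < card (S \<inter> {..<f})"
      by (intro psubset_card_mono) auto
  qed
qed

text \<open>The new element \<open>x\<close> is the ratio of \<open>T \<union> {x}\<close> because, below \<open>ratio T\<close>, the set \<open>T\<close> consists of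
  multiples of \<open>m\<close>, and \<open>x\<close>, lying outside \<open>T\<close>, is no multiple. A pair of consecutive elements
  below \<open>f\<close> in \<open>T \<union> {x}\<close> would have to contain \<open>x\<close> and a neighbour of \<open>x\<close>.\<close>

lemma AMED_child_iff:
  assumes T: "T \<in> AMED f m" and f: "\<not> m dvd f"
  shows "S \<in> AMED f m \<and> T = S - {ratio S} \<longleftrightarrow>
    (\<exists>x. S = T \<union> {x} \<and> T \<union> {x} \<in> MED f m \<and> x \<in> special_gaps T \<and>
      sg_multiplicity T < x \<and> x < ratio T \<and> {x + 1, x - 1} \<subseteq> gaps T)"
    (is "?L \<longleftrightarrow> (\<exists>x. ?P x)")
proof
  note rT = AMED_ratio[OF T f]
  have mT: "sg_multiplicity T = m" by (rule AMED_sg_multiplicity[OF T])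
  show "\<exists>x. ?P x" if L: ?L
  proof
    define x where "x = ratio S"
    have S: "S \<in> AMED f m" and T_eq: "T = S - {x}" using L x_def by auto
    note rS = AMED_ratio[OF S f, folded x_def]
    have S_eq: "S = T \<union> {x}" using T_eq rS(1) by blast
    have x0: "x > 0" using rS(2) by (cases x) auto
    have mon: "nat_submonoid S" using S unfolding AMED_iff by blast
    have "2 * x \<in> S" using nat_submonoid_multiple[OF mon rS(1)] .
    then have sg: "x \<in> special_gaps T"
      unfolding special_gaps_def T_eq using nat_submonoid_add[OF mon rS(1)] x0 by auto
    have "m \<le> x" "m \<noteq> x" using S rS(1,2) x0 unfolding AMED_iff by auto
    have "\<not> ratio T < x" using rS(3) rT(1,2) T_eq by blast
    moreover have "ratio T \<noteq> x" using rT(1) T_eq by blast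
    ultimately have less: "x < ratio T" by simp
    \<comment> \<open>As a gap of \<open>T\<close> that is not \<open>f\<close>, the number \<open>x\<close> is below \<open>f\<close>, so its neighbours are
      excluded by the absence of consecutive elements, or because \<open>x + 1 = f\<close>.\<close>
    have "x \<noteq> f" using S rS(1) unfolding AMED_iff by blast
    moreover have "x \<notin> {f + 1..}" using T T_eq unfolding AMED_iff by blast
    ultimately have xf: "x < f" by simp
    have "x + 1 \<notin> S"
      using S rS(1) xf unfolding AMED_iff by (metis Suc_eq_plus1 Suc_lessI)
    moreover have "x - 1 \<notin> S"
    proof
      assume "x - 1 \<in> S"
      moreover have "x - 1 + 1 = x" using x0 by simp
      ultimately show False using S rS(1) xf unfolding AMED_iff by metis
    qed
    moreover have "S \<in> MED f m" using S unfolding AMED_def MED_def by blast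
    ultimately show "?P x"
      using S_eq sg less \<open>m \<le> x\<close> \<open>m \<noteq> x\<close> mT by auto
  qed
  show ?L if "\<exists>x. ?P x"
  proof -
    from that mT obtain x where x: "S = T \<union> {x}" "S \<in> MED f m" "x \<in> special_gaps T" "m < x" "x < ratio T"
      "x + 1 \<notin> T" "x - 1 \<notin> T"
      by auto
    have xT: "x \<notin> T" using x(3) unfolding special_gaps_def by blast
    have S: "MED_semigroup S" "Fb S = int f" "sg_multiplicity S = m"
      using x(2) unfolding MED_def by auto
    have "s + 1 \<notin> S" if "s \<in> S" "s + 1 < f" for s
    proof
      assume "s + 1 \<in> S"
      then consider "s \<in> T" "s + 1 \<in> T" | "s = x" "s + 1 \<in> T" | "s \<in> T" "x = s + 1"
        using \<open>s \<in> S\<close> x(1) by auto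
      then show False
        using T \<open>s + 1 < f\<close> x(6,7) unfolding AMED_iff by cases auto
    qed
    then have "A_semigroup S"
      using S unfolding A_semigroup_def MED_semigroup_def by auto
    then have "S \<in> AMED f m" unfolding AMED_def using S by blast
    moreover have "ratio S = x"
    proof (rule ratio_eqI[OF S(3)])
      show "x \<in> S" using x(1) by simp
      have "k * m \<in> T" for k
        using T nat_submonoid_multiple unfolding AMED_iff by blast
      then show "\<not> m dvd x" using xT by (metis dvd_div_mult_self)
      show "m dvd y" if "y \<in> S" "y < x" for y
        using rT(3)[of y] that x(1,5) by auto
    qed
    ultimately show ?thesis using x(1) xT by auto
  qed
qed

theorem theorem44:
  fixes f m :: nat
  assumes "f > 0" and "m > 0" and "\<not> m dvd f" and "m \<le> f + 1"
  shows "is_tree_with_root (AMED_graph f m) (Delta f m) \<and>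
    (\<forall>T \<in> AMED f m. children (AMED_graph f m) T =
       {T \<union> {x} | x. T \<union> {x} \<in> MED f m \<and> x \<in> special_gaps T \<and>
          sg_multiplicity T < x \<and> x < ratio T \<and> {x + 1, x - 1} \<subseteq> gaps T})"
proof (intro conjI ballI)
  show "is_tree_with_root (AMED_graph f m) (Delta f m)"
    by (rule AMED_graph_is_tree[OF assms])
  fix T assume T: "T \<in> AMED f m"
  have "children (AMED_graph f m) T = {S. S \<in> AMED f m \<and> T = S - {ratio S}}"
    using T by (auto simp: children_def AMED_graph_def)
  then show "children (AMED_graph f m) T =
       {T \<union> {x} | x. T \<union> {x} \<in> MED f m \<and> x \<in> special_gaps T \<and>
          sg_multiplicity T < x \<and> x < ratio T \<and> {x + 1, x - 1} \<subseteq> gaps T}"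
    unfolding AMED_child_iff[OF T assms(3)] .
qed

end
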